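(* Let $d\ge1$, let $\mathbf{X}_1,\ldots,\mathbf{X}_m$ be i.i.d. with law $\mu_{\mathbf{X}}$ and, independently, $\mathbf{Y}_1,\ldots,\mathbf{Y}_n$ i.i.d. with law $\mu_{\mathbf{Y}}$, where $\mu_{\mathbf{X}},\mu_{\mathbf{Y}}\in\mathcal{P}_{ac}(\mathbb{R}^d)$, and let $\mathcal{H}_{m+n}^d\subset[0,1]^d$ be a fixed set of $m+n$ points. Under $\mathrm{H}_0:\mu_{\mathbf{X}}=\mu_{\mathbf{Y}}$, the distribution of $\mathrm{RE}_{m,n}^2$ is free of $\mu_{\mathbf{X}}\equiv\mu_{\mathbf{Y}}$ (i.e., it is the same for every common law in $\mathcal{P}_{ac}(\mathbb{R}^d)$).
   Context: $\mathcal{P}_{ac}(\mathbb{R}^d)$: Lebesgue absolutely continuous probability measures on $\mathbb{R}^d$. $S_N$: permutations of $\{1,\ldots,N\}$. Joint empirical rank map: write the pooled sample as $\mathbf{W}_1,\ldots,\mathbf{W}_{m+n}$ (the $\mathbf{X}_i$'s followed by the $\mathbf{Y}_j$'s) and $\mathcal{H}_{m+n}^d=\{\mathbf{h}_1,\ldots,\mathbf{h}_{m+n}\}$. Let $\hat\sigma\in\arg\min_{\sigma\in S_{m+n}}\sum_i\|\mathbf{W}_i-\mathbf{h}_{\sigma(i)}\|^2$ (almost surely unique), and $\hat R_{m,n}(\mathbf{W}_i):=\mathbf{h}_{\hat\sigma(i)}$. Rank energy statistic: $$\mathrm{RE}_{m,n}^2=\frac2{mn}\sum_{i=1}^m\sum_{j=1}^n\|\hat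 R_{m,n}(\mathbf{X}_i)-\hat R_{m,n}(\mathbf{Y}_j)\|-\frac1{m^2}\sum_{i,j=1}^m\|\hat R_{m,n}(\mathbf{X}_i)-\hat R_{m,n}(\mathbf{X}_j)\|-\frac1{n^2}\sum_{i,j=1}^n\|\hat R_{m,n}(\mathbf{Y}_i)-\hat R_{m,n}(\mathbf{Y}_j)\|.$$ *)

theory Defs
  imports "HOL-Probability.Probability"
begin

definition P_ac :: "(real ^ 'd::finite) measure set" where
  "P_ac = {\<mu>. prob_space \<mu> \<and> sets \<mu> = sets borel \<and> absolutely_continuous lborel \<mu>}"

text \<open>The observations are indexed from 1; values of the families outside
  \<open>{1..m}\<close> and \<open>{1..n}\<close> are irrelevant.\<close>

definition iid_sample ::
  "'a measure \<Rightarrow> nat \<Rightarrow> (nat \<Rightarrow> 'a \<Rightarrow> real ^ 'd::finite) \<Rightarrow> (real ^ 'd) measure \<Rightarrow> bool" where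
  "iid_sample M k X \<mu> \<longleftrightarrow>
     prob_space.indep_vars M (\<lambda>_. borel) X {1..k} \<and>
     (\<forall>i\<in>{1..k}. X i \<in> borel_measurable M \<and> distr M borel (X i) = \<mu>)"

definition two_sample ::
  "'a measure \<Rightarrow> nat \<Rightarrow> nat \<Rightarrow> (nat \<Rightarrow> 'a \<Rightarrow> real ^ 'd::finite) \<Rightarrow> (nat \<Rightarrow> 'a \<Rightarrow> real ^ 'd)
     \<Rightarrow> (real ^ 'd) measure \<Rightarrow> (real ^ 'd) measure \<Rightarrow> bool" where
  "two_sample M m n X Y \<mu>X \<mu>Y \<longleftrightarrow>
     prob_space M \<and> iid_sample M m X \<mu>X \<and> iid_sample M n Y \<mu>Y \<and>
     prob_space.indep_var M
       (\<Pi>\<^sub>M i\<in>{1..m}. borel) (\<lambda>\<omega>. \<lambda>i\<in>{1..m}. X i \<omega>)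
       (\<Pi>\<^sub>M j\<in>{1..n}. borel) (\<lambda>\<omega>. \<lambda>j\<in>{1..n}. Y j \<omega>)"

definition pooled :: "nat \<Rightarrow> (nat \<Rightarrow> 'b) \<Rightarrow> (nat \<Rightarrow> 'b) \<Rightarrow> nat \<Rightarrow> 'b" where
  "pooled m x y i = (if i \<le> m then x i else y (i - m))"

definition perms :: "nat \<Rightarrow> (nat \<Rightarrow> nat) set" where
  "perms N = {\<sigma>. \<sigma> permutes {1..N}}"

definition optimal_assignment ::
  "nat \<Rightarrow> (nat \<Rightarrow> real ^ 'd::finite) \<Rightarrow> (nat \<Rightarrow> real ^ 'd) \<Rightarrow> (nat \<Rightarrow> nat) \<Rightarrow> bool" where
  "optimal_assignment N h w \<sigma> \<longleftrightarrow>
     is_arg_min (\<lambda>\<tau>. \<Sum>i=1..N. (norm (w i - h (\<tau> i)))\<^sup>2) (\<lambda>\<tau>. \<tau> \<in> perms N) \<sigma>"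

text \<open>Minimisers are unique only almost surely, so \<open>\<sigma>\<close> is an arbitrary
  everywhere-minimising choice; its measurability ensures that statistics built from it
  have a law.\<close>

definition empirical_assignment ::
  "'a measure \<Rightarrow> nat \<Rightarrow> nat \<Rightarrow> (nat \<Rightarrow> real ^ 'd::finite) \<Rightarrow> (nat \<Rightarrow> 'a \<Rightarrow> real ^ 'd)
     \<Rightarrow> (nat \<Rightarrow> 'a \<Rightarrow> real ^ 'd) \<Rightarrow> ('a \<Rightarrow> nat \<Rightarrow> nat) \<Rightarrow> bool" where
  "empirical_assignment M m n h X Y \<sigma> \<longleftrightarrow>
     \<sigma> \<in> measurable M (count_space (perms (m + n))) \<and>
     (\<forall>\<omega>\<in>space M.
        optimal_assignment (m + n) h (pooled m (\<lambda>i. X i \<omega>) (\<lambda>j. Y j \<omega>)) (\<sigma> \<omega>))"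

text \<open>\<open>R i\<close> is the rank vector of the \<open>i\<close>-th pooled observation, so that the rank of
  \<open>Y\<^sub>j\<close> is \<open>R (m + j)\<close>.\<close>

definition rank_energy :: "nat \<Rightarrow> nat \<Rightarrow> (nat \<Rightarrow> real ^ 'd::finite) \<Rightarrow> real" where
  "rank_energy m n R =
     2 / (real m * real n) * (\<Sum>i=1..m. \<Sum>j=1..n. norm (R i - R (m + j)))
     - 1 / (real m)\<^sup>2 * (\<Sum>i=1..m. \<Sum>j=1..m. norm (R i - R j))
     - 1 / (real n)\<^sup>2 * (\<Sum>i=1..n. \<Sum>j=1..n. norm (R (m + i) - R (m + j)))"

definition RE2 ::
  "nat \<Rightarrow> nat \<Rightarrow> (nat \<Rightarrow> real ^ 'd::finite) \<Rightarrow> ('a \<Rightarrow> nat \<Rightarrow> nat) \<Rightarrow> 'a \<Rightarrow> real" where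
  "RE2 m n h \<sigma> \<omega> = rank_energy m n (\<lambda>i. h (\<sigma> \<omega> i))"

end

theory Submission
  imports Defs
begin

text \<open>Under the null hypothesis the optimal assignment \<open>\<sigma>\<close> is uniformly distributed on the
  permutations, whatever the common law \<open>\<mu>\<close>, and the statistic is a function of \<open>\<sigma>\<close> alone.
  Indeed two distinct permutations have equal cost only if the pooled sample lies on a
  hyperplane, which has probability zero because \<open>\<mu>\<close> does not charge hyperplanes. So, almost
  surely, \<open>\<sigma> = \<tau>\<close> iff \<open>\<tau>\<close> is optimal for the pooled sample. The pooled sample is
  exchangeable and relabelling it by a permutation composes the optimal assignments with that
  permutation, so this probability does not depend on \<open>\<tau>\<close>.\<close>

section \<open>Null hyperplanes of absolutely continuous laws and of their powers\<close>

lemma P_ac_hyperplane_null: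
  fixes \<mu> :: "(real ^ 'd::finite) measure"
  assumes "\<mu> \<in> P_ac" and "a \<noteq> 0"
  shows "AE x in \<mu>. a \<bullet> x \<noteq> b"
proof -
  have sets: "sets \<mu> = sets borel" and ac: "absolutely_continuous lborel \<mu>"
    using assms(1) by (auto simp: P_ac_def)
  \<comment> \<open>Negligibility speaks of the completed Lebesgue measure; Borel measurability
    brings the null set down to \<open>lborel\<close>.\<close>
  have "{x. a \<bullet> x = b} \<in> sets lborel"
    by measurable
  then have "{x. a \<bullet> x = b} \<in> null_sets lborel"
    using negligible_hyperplane[of a b] assms(2)
    by (simp add: negligible_iff_null_sets null_sets_completion_iff)
  then have "{x. a \<bullet> x = b} \<in> null_sets \<mu>"
    using ac by (auto simp: absolutely_continuous_def)
  then show ?thesis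
    by (rule AE_I') auto
qed

text \<open>By Fubini, coordinate \<open>k\<close> can be integrated first with the others frozen;
  the equation then confines it to a hyperplane with normal \<open>v k\<close>, which is null for
  \<open>\<mu>\<close>.\<close>

lemma PiM_hyperplane_null:
  fixes \<mu> :: "(real ^ 'd::finite) measure"
  assumes \<mu>: "\<mu> \<in> P_ac" and I: "finite I" and k: "k \<in> I" "v k \<noteq> 0"
  shows "AE w in (\<Pi>\<^sub>M i\<in>I. \<mu>). (\<Sum>i\<in>I. v i \<bullet> w i) \<noteq> c"
proof -
  interpret prob_space \<mu>
    using \<mu> by (simp add: P_ac_def)
  interpret product_sigma_finite "\<lambda>_. \<mu>"
    by unfold_locales
  have [measurable_cong]: "sets \<mu> = sets borel"
    using \<mu> by (simp add: P_ac_def)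
  define J where "J = I - {k}"
  have J: "I = insert k J" "k \<notin> J" "finite J"
    using I k by (auto simp: J_def)
  define E where "E = {w \<in> space (\<Pi>\<^sub>M i\<in>I. \<mu>). (\<Sum>i\<in>I. v i \<bullet> w i) = c}"
  have E[measurable]: "E \<in> sets (\<Pi>\<^sub>M i\<in>I. \<mu>)"
    unfolding E_def by measurable
  have "emeasure (\<Pi>\<^sub>M i\<in>I. \<mu>) E = (\<integral>\<^sup>+w. indicator E w \<partial>(\<Pi>\<^sub>M i\<in>I. \<mu>))"
    by simp
  also have "\<dots> = (\<integral>\<^sup>+w. (\<integral>\<^sup>+x. indicator E (w(k := x)) \<partial>\<mu>) \<partial>(\<Pi>\<^sub>M i\<in>J. \<mu>))"
    using E unfolding J(1) by (intro product_nn_integral_insert J) auto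
  also have "\<dots> = (\<integral>\<^sup>+w. 0 \<partial>(\<Pi>\<^sub>M i\<in>J. \<mu>))"
  proof (rule nn_integral_cong)
    fix w
    have "AE x in \<mu>. v k \<bullet> x \<noteq> c - (\<Sum>i\<in>J. v i \<bullet> w i)"
      by (rule P_ac_hyperplane_null[OF \<mu> k(2)])
    then have "AE x in \<mu>. indicator E (w(k := x)) = (0 :: ennreal)"
    proof eventually_elim
      case (elim x)
      have "(\<Sum>i\<in>J. v i \<bullet> (w(k := x)) i) = (\<Sum>i\<in>J. v i \<bullet> w i)"
        using J(2) by (intro sum.cong) auto
      then have "(\<Sum>i\<in>I. v i \<bullet> (w(k := x)) i) = v k \<bullet> x + (\<Sum>i\<in>J. v i \<bullet> w i)"
        using J by simp
      then show ?case
        using elim by (simp add: E_def indicator_def)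
    qed
    then show "(\<integral>\<^sup>+x. indicator E (w(k := x)) \<partial>\<mu>) = 0"
      by (subst nn_integral_cong_AE[where v = "\<lambda>_. 0"]) auto
  qed
  finally have "E \<in> null_sets (\<Pi>\<^sub>M i\<in>I. \<mu>)"
    using E by (simp add: null_sets_def)
  then show ?thesis
    by (rule AE_I') (auto simp: E_def)
qed

section \<open>Algebra of the assignment cost\<close>

definition assignment_cost ::
  "nat \<Rightarrow> (nat \<Rightarrow> real ^ 'd::finite) \<Rightarrow> (nat \<Rightarrow> real ^ 'd) \<Rightarrow> (nat \<Rightarrow> nat) \<Rightarrow> real" where
  "assignment_cost N h w \<tau> = (\<Sum>i=1..N. (norm (w i - h (\<tau> i)))\<^sup>2)"

lemma optimal_assignment_iff:
  "optimal_assignment N h w \<sigma> \<longleftrightarrow>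
     \<sigma> \<in> perms N \<and> (\<forall>\<tau>\<in>perms N. assignment_cost N h w \<sigma> \<le> assignment_cost N h w \<tau>)"
  by (auto simp: optimal_assignment_def is_arg_min_linorder assignment_cost_def)

lemma finite_perms: "finite (perms N)"
  by (simp add: perms_def finite_permutations)

lemma assignment_cost_cong:
  "(\<And>i. i \<in> {1..N} \<Longrightarrow> w i = w' i) \<Longrightarrow> assignment_cost N h w = assignment_cost N h w'"
  by (intro ext) (auto simp: assignment_cost_def intro!: sum.cong)

lemma assignment_cost_relabel:
  assumes "\<pi> \<in> perms N"
  shows "assignment_cost N h (\<lambda>i. w (\<pi> i)) (\<tau> \<circ> \<pi>) = assignment_cost N h w \<tau>"
  using assms sum.permute[of \<pi> "{1..N}" "\<lambda>i. (norm (w i - h (\<tau> i)))\<^sup>2"]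
  by (simp add: assignment_cost_def perms_def o_def)

text \<open>Composition with \<open>\<pi>\<close> on the right is a bijection of
  \<open>perms N\<close> that preserves costs when the sample is relabelled along, so minimisers go
  to minimisers.\<close>

lemma optimal_assignment_relabel:
  assumes \<pi>: "\<pi> \<in> perms N"
  shows "optimal_assignment N h (\<lambda>i. w (\<pi> i)) (\<tau> \<circ> \<pi>) \<longleftrightarrow> optimal_assignment N h w \<tau>"
proof -
  have p: "\<pi> permutes {1..N}"
    using \<pi> by (simp add: perms_def)
  have image: "(\<lambda>\<rho>. \<rho> \<circ> \<pi>) ` perms N = perms N"
    using image_compose_permutations_right[OF p] by (auto simp: perms_def image_iff)
  \<comment> \<open>Here \<open>\<tau>\<close> is an arbitrary function, so injectivity on all
    functions is what recovers \<open>\<tau> \<in> perms N\<close> from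
    \<open>\<tau> \<circ> \<pi> \<in> perms N\<close>.\<close>
  have "inj (\<lambda>\<rho>. \<rho> \<circ> \<pi>)"
    using permutes_surj[OF p] by (auto intro!: injI simp: fun_eq_iff) (metis surjD)
  then have "\<tau> \<circ> \<pi> \<in> perms N \<longleftrightarrow> \<tau> \<in> perms N"
    using inj_image_mem_iff[of "\<lambda>\<rho>. \<rho> \<circ> \<pi>" \<tau> "perms N"] image by simp
  moreover have "(\<forall>\<rho>\<in>perms N. c \<le> assignment_cost N h (\<lambda>i. w (\<pi> i)) \<rho>) \<longleftrightarrow>
      (\<forall>\<rho>\<in>perms N. c \<le> assignment_cost N h w \<rho>)" for c
    by (subst image[symmetric]) (simp add: assignment_cost_relabel[OF \<pi>])
  ultimately show ?thesis
    by (simp add: optimal_assignment_iff assignment_cost_relabel[OF \<pi>])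
qed

text \<open>When the squares are expanded, the squared norms of the \<open>w i\<close> and of the
  \<open>h (\<sigma> i)\<close> have sums common to all permutations, and only the cross terms
  survive. A tie between two permutations is therefore a linear equation in the sample.\<close>

lemma assignment_cost_diff:
  assumes "\<sigma> \<in> perms N" "\<tau> \<in> perms N"
  shows "assignment_cost N h w \<sigma> - assignment_cost N h w \<tau> =
    2 * (\<Sum>i=1..N. (h (\<tau> i) - h (\<sigma> i)) \<bullet> w i)"
proof -
  have *: "assignment_cost N h w \<rho> =
      (\<Sum>i=1..N. w i \<bullet> w i) - 2 * (\<Sum>i=1..N. h (\<rho> i) \<bullet> w i) + (\<Sum>i=1..N. h i \<bullet> h i)"
    if "\<rho> \<in> perms N" for \<rho>
  proof -
    have "(\<Sum>i=1..N. h (\<rho> i) \<bullet> h (\<rho> i)) = (\<Sum>i=1..N. h i \<bullet> h i)"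
      using that sum.permute[of \<rho> "{1..N}" "\<lambda>i. h i \<bullet> h i"] by (simp add: perms_def o_def)
    moreover have "assignment_cost N h w \<rho> =
        (\<Sum>i=1..N. w i \<bullet> w i - 2 * (h (\<rho> i) \<bullet> w i) + h (\<rho> i) \<bullet> h (\<rho> i))"
      unfolding assignment_cost_def
      by (intro sum.cong) (auto simp: power2_norm_eq_inner inner_diff_left inner_diff_right inner_commute)
    ultimately show ?thesis
      by (simp add: sum.distrib sum_subtractf sum_distrib_left)
  qed
  show ?thesis
    using assms by (simp add: * inner_diff_left sum_subtractf)
qed

section \<open>Uniqueness and exchangeability of optimal assignments\<close>

text \<open>Injectivity of \<open>h\<close> gives distinct permutations a nonzero coefficient in
  \<open>assignment_cost_diff\<close>, so each tie is a null event, and only finitely many pairs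
  have to be excluded.\<close>

lemma AE_optimal_assignment_unique:
  fixes \<mu> :: "(real ^ 'd::finite) measure"
  assumes \<mu>: "\<mu> \<in> P_ac" and inj: "inj_on h {1..N}"
  shows "AE w in (\<Pi>\<^sub>M i\<in>{1..N}. \<mu>). \<forall>\<sigma> \<tau>.
    optimal_assignment N h w \<sigma> \<longrightarrow> optimal_assignment N h w \<tau> \<longrightarrow> \<sigma> = \<tau>"
proof -
  have "AE w in (\<Pi>\<^sub>M i\<in>{1..N}. \<mu>). assignment_cost N h w \<sigma> \<noteq> assignment_cost N h w \<tau>"
    if \<sigma>: "\<sigma> \<in> perms N" and \<tau>: "\<tau> \<in> perms N" and "\<sigma> \<noteq> \<tau>" for \<sigma> \<tau>
  proof -
    have p: "\<sigma> permutes {1..N}" "\<tau> permutes {1..N}"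
      using \<sigma> \<tau> by (auto simp: perms_def)
    obtain k where k: "\<sigma> k \<noteq> \<tau> k"
      using \<open>\<sigma> \<noteq> \<tau>\<close> by auto
    \<comment> \<open>Both permutations fix every index outside \<open>{1..N}\<close>, so they can
      differ only inside.\<close>
    then have kN: "k \<in> {1..N}"
      using p by (metis permutes_not_in)
    then have "\<sigma> k \<in> {1..N}" "\<tau> k \<in> {1..N}"
      using p by (metis permutes_in_image)+
    then have "h (\<tau> k) - h (\<sigma> k) \<noteq> 0"
      using k inj by (metis inj_on_eq_iff right_minus_eq)
    then have "AE w in (\<Pi>\<^sub>M i\<in>{1..N}. \<mu>). (\<Sum>i=1..N. (h (\<tau> i) - h (\<sigma> i)) \<bullet> w i) \<noteq> 0"
      using kN by (intro PiM_hyperplane_null[OF \<mu>, where k = k]) auto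
    then show ?thesis
    proof eventually_elim
      case (elim w)
      then show ?case
        using assignment_cost_diff[OF \<sigma> \<tau>, of h w] by auto
    qed
  qed
  then have "AE w in (\<Pi>\<^sub>M i\<in>{1..N}. \<mu>). \<forall>\<sigma>\<in>perms N. \<forall>\<tau>\<in>perms N.
      \<sigma> \<noteq> \<tau> \<longrightarrow> assignment_cost N h w \<sigma> \<noteq> assignment_cost N h w \<tau>"
    by (intro AE_finite_allI finite_perms) (auto intro!: AE_impI)
  then show ?thesis
  proof eventually_elim
    case (elim w)
    then show ?case
      unfolding optimal_assignment_iff by (meson order_antisym)
  qed
qed

text \<open>Minimality over the finite set \<open>perms N\<close> is a finite conjunction of
  inequalities between measurable costs.\<close>

lemma sets_optimal_assignment:
  fixes \<mu> :: "(real ^ 'd::finite) measure"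
  assumes [measurable_cong]: "sets \<mu> = sets borel"
  shows "{w \<in> space (\<Pi>\<^sub>M i\<in>{1..N}. \<mu>). optimal_assignment N h w \<tau>}
    \<in> sets (\<Pi>\<^sub>M i\<in>{1..N}. \<mu>)"
proof -
  have cost: "(\<lambda>w. assignment_cost N h w \<rho>) \<in> borel_measurable (\<Pi>\<^sub>M i\<in>{1..N}. \<mu>)" for \<rho>
    unfolding assignment_cost_def by measurable
  show ?thesis
    unfolding optimal_assignment_iff
    by (intro predE pred_intros_logic pred_intros_finite finite_perms)
      (simp_all add: pred_def borel_measurable_le cost del: One_nat_def)
qed

text \<open>Permuting the coordinates by the inverse of \<open>\<tau>\<close> preserves the product
  measure and turns optimality of \<open>\<tau>\<close> into optimality of
  \<open>id\<close>.\<close>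

lemma emeasure_optimal_assignment_eq:
  fixes \<mu> :: "(real ^ 'd::finite) measure"
  assumes \<mu>: "\<mu> \<in> P_ac" and \<tau>: "\<tau> \<in> perms N"
  defines "P \<equiv> \<Pi>\<^sub>M i\<in>{1..N}. \<mu>"
  shows "emeasure P {w \<in> space P. optimal_assignment N h w \<tau>} =
    emeasure P {w \<in> space P. optimal_assignment N h w id}"
proof -
  have \<mu>': "prob_space \<mu>" "sets \<mu> = sets borel"
    using \<mu> by (auto simp: P_ac_def)
  define \<pi> where "\<pi> = inv \<tau>"
  have "\<tau> permutes {1..N}"
    using \<tau> by (simp add: perms_def)
  then have p: "\<pi> permutes {1..N}" and inv: "\<tau> \<circ> \<pi> = id"
    by (auto simp: \<pi>_def permutes_inv permutes_inv_o)
  then have \<pi>: "\<pi> \<in> perms N"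
    by (simp add: perms_def)
  \<comment> \<open>The restriction keeps \<open>f w\<close> in the extensional function space
    underlying \<open>P\<close>; costs look only at indices in \<open>{1..N}\<close>.\<close>
  define f :: "(nat \<Rightarrow> real ^ 'd) \<Rightarrow> nat \<Rightarrow> real ^ 'd" where
    "f = (\<lambda>w. \<lambda>i\<in>{1..N}. w (\<pi> i))"
  have in_N: "\<pi> i \<in> {1..N}" if "i \<in> {1..N}" for i
    using p that by (metis permutes_in_image)
  have f: "f \<in> measurable P P"
    unfolding f_def P_def by (intro measurable_restrict measurable_component_singleton in_N)
  have distr: "distr P P f = P"
    unfolding P_def f_def
    using \<mu>'(1) p in_N by (intro distr_PiM_reindex) (auto intro: permutes_inj_on)
  have opt: "optimal_assignment N h (f w) id \<longleftrightarrow> optimal_assignment N h w \<tau>" for w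
  proof -
    have "assignment_cost N h (f w) = assignment_cost N h (\<lambda>i. w (\<pi> i))"
      by (rule assignment_cost_cong) (simp add: f_def)
    then show ?thesis
      using optimal_assignment_relabel[OF \<pi>, of h w \<tau>]
      by (simp add: inv optimal_assignment_iff)
  qed
  let ?E = "{w \<in> space P. optimal_assignment N h w id}"
  have "emeasure P ?E = emeasure (distr P P f) ?E"
    by (simp add: distr)
  also have "\<dots> = emeasure P (f -` ?E \<inter> space P)"
    using sets_optimal_assignment[OF \<mu>'(2), of N h id] f
    by (intro emeasure_distr) (auto simp: P_def)
  also have "f -` ?E \<inter> space P = {w \<in> space P. optimal_assignment N h w \<tau>}"
    using measurable_space[OF f] opt by auto
  finally show ?thesis
    by (rule sym)
qed

section \<open>Law of the pooled sample\<close>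

text \<open>A finite product measure is determined by rectangles. The probability of a rectangle
  factors first between the two samples, then within each of them.\<close>

lemma distr_pooled:
  fixes \<mu> :: "(real ^ 'd::finite) measure"
  assumes ts: "two_sample M m n X Y \<mu> \<mu>" and mn: "m \<ge> 1" "n \<ge> 1"
  defines "W \<equiv> \<lambda>\<omega>. \<lambda>i\<in>{1..m + n}. pooled m (\<lambda>i. X i \<omega>) (\<lambda>j. Y j \<omega>) i"
  shows "W \<in> measurable M (\<Pi>\<^sub>M i\<in>{1..m + n}. borel)"
    and "distr M (\<Pi>\<^sub>M i\<in>{1..m + n}. borel) W = (\<Pi>\<^sub>M i\<in>{1..m + n}. \<mu>)"
proof -
  interpret prob_space M
    using ts by (simp add: two_sample_def)
  have X: "indep_vars (\<lambda>_. borel) X {1..m}"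
      "\<And>i. i \<in> {1..m} \<Longrightarrow> X i \<in> borel_measurable M"
      "\<And>i. i \<in> {1..m} \<Longrightarrow> distr M borel (X i) = \<mu>"
    and Y: "indep_vars (\<lambda>_. borel) Y {1..n}"
      "\<And>i. i \<in> {1..n} \<Longrightarrow> Y i \<in> borel_measurable M"
      "\<And>i. i \<in> {1..n} \<Longrightarrow> distr M borel (Y i) = \<mu>"
    and XY: "indep_var (\<Pi>\<^sub>M i\<in>{1..m}. borel) (\<lambda>\<omega>. \<lambda>i\<in>{1..m}. X i \<omega>)
       (\<Pi>\<^sub>M j\<in>{1..n}. borel) (\<lambda>\<omega>. \<lambda>j\<in>{1..n}. Y j \<omega>)"
    using ts by (auto simp: two_sample_def iid_sample_def)
  \<comment> \<open>That \<open>\<mu>\<close> is a probability measure is read off from the first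
    observation, which exists because \<open>m \<ge> 1\<close>.\<close>
  have \<mu>: "\<mu> = distr M borel (X 1)"
    using X(3)[of 1] mn by simp
  interpret \<mu>: prob_space \<mu>
    unfolding \<mu> using X(2)[of 1] mn by (intro prob_space_distr) auto
  interpret product_sigma_finite "\<lambda>_. \<mu>"
    by unfold_locales
  have sets_\<mu>: "sets \<mu> = sets borel"
    unfolding \<mu> by simp
  have "(\<lambda>\<omega>. pooled m (\<lambda>i. X i \<omega>) (\<lambda>j. Y j \<omega>) i) \<in> borel_measurable M"
    if "i \<in> {1..m + n}" for i
  proof (cases "i \<le> m")
    case True
    then show ?thesis
      using that X(2)[of i] by (simp add: pooled_def)
  next
    case False
    then show ?thesis
      using that Y(2)[of "i - m"] by (simp add: pooled_def le_diff_conv Suc_le_eq)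
  qed
  then show W: "W \<in> measurable M (\<Pi>\<^sub>M i\<in>{1..m + n}. borel)"
    unfolding W_def by (intro measurable_restrict)
  show "distr M (\<Pi>\<^sub>M i\<in>{1..m + n}. borel) W = (\<Pi>\<^sub>M i\<in>{1..m + n}. \<mu>)"
  proof (rule PiM_eqI)
    show "sets (distr M (\<Pi>\<^sub>M i\<in>{1..m + n}. borel) W) = sets (\<Pi>\<^sub>M i\<in>{1..m + n}. \<mu>)"
      by (simp add: sets_\<mu> cong: sets_PiM_cong)
    fix A assume "\<And>i. i \<in> {1..m + n} \<Longrightarrow> A i \<in> sets \<mu>"
    then have A: "A i \<in> sets borel" if "i \<in> {1..m + n}" for i
      using that by (simp add: sets_\<mu>)
    let ?A = "Pi\<^sub>E {1..m} A" and ?B = "Pi\<^sub>E {1..n} (\<lambda>j. A (m + j))"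
    have \<mu>X: "prob (X i -` B \<inter> space M) = measure \<mu> B" if "i \<in> {1..m}" "B \<in> sets borel" for i B
      using X(2,3)[OF that(1)] that(2) by (metis measure_distr)
    have \<mu>Y: "prob (Y i -` B \<inter> space M) = measure \<mu> B" if "i \<in> {1..n}" "B \<in> sets borel" for i B
      using Y(2,3)[OF that(1)] that(2) by (metis measure_distr)
    have split: "{1..m + n} = {1..m} \<union> (\<lambda>j. m + j) ` {1..n}"
      by (simp add: image_add_atLeastAtMost) auto
    have "W -` Pi\<^sub>E {1..m + n} A \<inter> space M =
        (\<lambda>\<omega>. (\<lambda>i\<in>{1..m}. X i \<omega>, \<lambda>j\<in>{1..n}. Y j \<omega>)) -` (?A \<times> ?B) \<inter> space M"
      unfolding W_def vimage_def split
      by (auto simp: PiE_iff pooled_def ball_Un simp del: image_add_atLeastAtMost)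
    then have "prob (W -` Pi\<^sub>E {1..m + n} A \<inter> space M) =
        prob ((\<lambda>\<omega>. \<lambda>i\<in>{1..m}. X i \<omega>) -` ?A \<inter> space M) *
        prob ((\<lambda>\<omega>. \<lambda>j\<in>{1..n}. Y j \<omega>) -` ?B \<inter> space M)"
      using A by (simp only:) (intro indep_varD[OF XY] sets_PiM_I_finite; simp)
    \<comment> \<open>An empty intersection would be the whole type instead of
      \<open>space M\<close>; \<open>m \<ge> 1\<close> rules this out.\<close>
    also have "(\<lambda>\<omega>. \<lambda>i\<in>{1..m}. X i \<omega>) -` ?A \<inter> space M = (\<Inter>i\<in>{1..m}. X i -` A i \<inter> space M)"
      using mn by (auto simp: PiE_iff)
    also have "prob \<dots> = (\<Prod>i\<in>{1..m}. measure \<mu> (A i))"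
      using mn A by (subst indep_varsD_finite[OF X(1)]) (auto intro!: prod.cong \<mu>X)
    also have "(\<lambda>\<omega>. \<lambda>j\<in>{1..n}. Y j \<omega>) -` ?B \<inter> space M =
        (\<Inter>j\<in>{1..n}. Y j -` A (m + j) \<inter> space M)"
      using mn by (auto simp: PiE_iff)
    also have "prob \<dots> = (\<Prod>j\<in>{1..n}. measure \<mu> (A (m + j)))"
      using mn A by (subst indep_varsD_finite[OF Y(1)]) (auto intro!: prod.cong \<mu>Y)
    also have "\<dots> = (\<Prod>i\<in>(\<lambda>j. m + j) ` {1..n}. measure \<mu> (A i))"
      by (subst prod.reindex) auto
    also have "(\<Prod>i\<in>{1..m}. measure \<mu> (A i)) * \<dots> = (\<Prod>i\<in>{1..m + n}. measure \<mu> (A i))"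
      unfolding split by (intro prod.union_disjoint[symmetric]) auto
    finally have "prob (W -` Pi\<^sub>E {1..m + n} A \<inter> space M) = (\<Prod>i\<in>{1..m + n}. measure \<mu> (A i))" .
    moreover have "Pi\<^sub>E {1..m + n} A \<in> sets (\<Pi>\<^sub>M i\<in>{1..m + n}. borel)"
      using A by (intro sets_PiM_I_finite) auto
    ultimately show "emeasure (distr M (\<Pi>\<^sub>M i\<in>{1..m + n}. borel) W) (Pi\<^sub>E {1..m + n} A) =
        (\<Prod>i\<in>{1..m + n}. emeasure \<mu> (A i))"
      using W by (simp add: emeasure_distr emeasure_eq_measure \<mu>.emeasure_eq_measure prod_ennreal)
  qed simp
qed

section \<open>Uniform law of the assignment and conclusion\<close>

text \<open>Ties have probability zero, so the way \<open>\<sigma>\<close> chooses among minimisers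
  does not affect its law, which is then governed by the pooled sample alone.\<close>

lemma distr_empirical_assignment:
  fixes \<mu> :: "(real ^ 'd::finite) measure"
  assumes mn: "m \<ge> 1" "n \<ge> 1" and inj: "inj_on h {1..m + n}"
    and \<mu>: "\<mu> \<in> P_ac" and ts: "two_sample M m n X Y \<mu> \<mu>"
    and ea: "empirical_assignment M m n h X Y \<sigma>"
  shows "distr M (count_space (perms (m + n))) \<sigma> = uniform_count_measure (perms (m + n))"
proof -
  define N where "N = m + n"
  define W where "W = (\<lambda>\<omega>. \<lambda>i\<in>{1..N}. pooled m (\<lambda>i. X i \<omega>) (\<lambda>j. Y j \<omega>) i)"
  define P where "P = (\<Pi>\<^sub>M i\<in>{1..N}. \<mu>)"
  \<comment> \<open>The probability that the identity is optimal; it will be the common mass of all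
    permutations.\<close>
  define p where "p = measure P {w \<in> space P. optimal_assignment N h w id}"
  interpret prob_space M
    using ts by (simp add: two_sample_def)
  have sets_\<mu>: "sets \<mu> = sets borel"
    using \<mu> by (simp add: P_ac_def)
  have sets_P: "sets P = sets (\<Pi>\<^sub>M i\<in>{1..N}. borel)"
    unfolding P_def by (simp add: sets_\<mu> cong: sets_PiM_cong)
  have W: "W \<in> measurable M P"
    using distr_pooled(1)[OF ts mn] by (simp add: W_def N_def measurable_cong_sets[OF refl sets_P])
  have distr_W: "distr M P W = P"
    using distr_pooled(2)[OF ts mn] distr_cong[OF refl sets_P, of M W W]
    by (simp add: W_def N_def P_def)
  have \<sigma>: "\<sigma> \<in> measurable M (count_space (perms N))"
    using ea by (simp add: empirical_assignment_def N_def)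
  have opt: "optimal_assignment N h (W \<omega>) (\<sigma> \<omega>)" if "\<omega> \<in> space M" for \<omega>
  proof -
    have "assignment_cost N h (W \<omega>) = assignment_cost N h (pooled m (\<lambda>i. X i \<omega>) (\<lambda>j. Y j \<omega>))"
      by (rule assignment_cost_cong) (simp add: W_def)
    then show ?thesis
      using ea that by (simp add: empirical_assignment_def N_def optimal_assignment_iff)
  qed
  have "AE w in distr M P W. \<forall>\<sigma> \<tau>.
      optimal_assignment N h w \<sigma> \<longrightarrow> optimal_assignment N h w \<tau> \<longrightarrow> \<sigma> = \<tau>"
    unfolding distr_W unfolding P_def
    using inj by (intro AE_optimal_assignment_unique[OF \<mu>]) (simp add: N_def)
  then have unique: "AE \<omega> in M. \<forall>\<sigma> \<tau>.
      optimal_assignment N h (W \<omega>) \<sigma> \<longrightarrow> optimal_assignment N h (W \<omega>) \<tau> \<longrightarrow> \<sigma> = \<tau>"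
    by (rule AE_distrD[OF W])
  define D where "D = distr M (count_space (perms N)) \<sigma>"
  interpret D: prob_space D
    unfolding D_def by (rule prob_space_distr[OF \<sigma>])
  have sets_D: "sets D = Pow (perms N)" and space_D: "space D = perms N"
    by (simp_all add: D_def)
  have prob: "D.prob {\<tau>} = p" if \<tau>: "\<tau> \<in> perms N" for \<tau>
  proof -
    let ?E = "{w \<in> space P. optimal_assignment N h w \<tau>}"
    have E: "?E \<in> sets P"
      unfolding P_def by (rule sets_optimal_assignment[OF sets_\<mu>])
    have "emeasure D {\<tau>} = emeasure M (\<sigma> -` {\<tau>} \<inter> space M)"
      unfolding D_def using \<tau> by (intro emeasure_distr[OF \<sigma>]) auto
    also have "\<dots> = emeasure M (W -` ?E \<inter> space M)"
    proof (rule emeasure_eq_AE)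
      \<comment> \<open>From left to right this is \<open>opt\<close>; from right to left,
        \<open>\<tau>\<close> and \<open>\<sigma> \<omega>\<close> are both optimal and coincide by
        \<open>unique\<close>.\<close>
      show "AE \<omega> in M. \<omega> \<in> \<sigma> -` {\<tau>} \<inter> space M \<longleftrightarrow> \<omega> \<in> W -` ?E \<inter> space M"
        using unique AE_space
      proof eventually_elim
        case (elim \<omega>)
        then show ?case
          using opt[of \<omega>] measurable_space[OF W] by auto
      qed
    qed (use \<tau> \<sigma> W E in \<open>auto intro: measurable_sets\<close>)
    also have "\<dots> = emeasure (distr M P W) ?E"
      using W E by (simp add: emeasure_distr)
    also have "\<dots> = emeasure P {w \<in> space P. optimal_assignment N h w id}"
      unfolding distr_W unfolding P_def by (rule emeasure_optimal_assignment_eq[OF \<mu> \<tau>])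
    finally show ?thesis
      by (simp add: measure_def p_def)
  qed
  \<comment> \<open>Finitely many atoms of equal mass \<open>p\<close> add up to one, which
    determines \<open>p\<close>.\<close>
  have "1 = D.prob (perms N)"
    using D.prob_space by (simp add: space_D)
  also have "\<dots> = (\<Sum>\<tau>\<in>perms N. D.prob {\<tau>})"
    by (intro D.finite_measure_eq_sum_singleton finite_perms) (simp add: sets_D)
  also have "\<dots> = card (perms N) * p"
    by (simp add: prob)
  finally have p: "p = 1 / card (perms N)"
    by (metis nonzero_eq_divide_eq mult.commute mult_zero_left zero_neq_one)
  show ?thesis
    unfolding N_def[symmetric] D_def[symmetric]
  proof (rule measure_eqI_finite)
    fix \<tau> assume "\<tau> \<in> perms N"
    then show "emeasure D {\<tau>} =
        emeasure (uniform_count_measure (perms N)) {\<tau>}"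
      by (simp add: D.emeasure_eq_measure prob p emeasure_uniform_count_measure finite_perms)
  qed (simp_all add: finite_perms sets_D sets_uniform_count_measure)
qed

theorem lemma4p3:
  fixes m n :: nat
    and H :: "(real ^ 'd::finite) set" and h :: "nat \<Rightarrow> real ^ 'd"
    and M :: "'a measure" and M' :: "'b measure"
    and X Y :: "nat \<Rightarrow> 'a \<Rightarrow> real ^ 'd" and X' Y' :: "nat \<Rightarrow> 'b \<Rightarrow> real ^ 'd"
    and \<mu> \<mu>' :: "(real ^ 'd) measure"
    and \<sigma> :: "'a \<Rightarrow> nat \<Rightarrow> nat" and \<sigma>' :: "'b \<Rightarrow> nat \<Rightarrow> nat"
  assumes "m \<ge> 1" and "n \<ge> 1"
    and "H \<subseteq> {x. \<forall>k. 0 \<le> x $ k \<and> x $ k \<le> 1}"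
    and "bij_betw h {1..m + n} H"
    and "\<mu> \<in> P_ac" and "two_sample M m n X Y \<mu> \<mu>"
    and "empirical_assignment M m n h X Y \<sigma>"
    and "\<mu>' \<in> P_ac" and "two_sample M' m n X' Y' \<mu>' \<mu>'"
    and "empirical_assignment M' m n h X' Y' \<sigma>'"
  shows "distr M borel (RE2 m n h \<sigma>) = distr M' borel (RE2 m n h \<sigma>')"
proof -
  let ?S = "count_space (perms (m + n))" and ?g = "\<lambda>\<tau>. rank_energy m n (\<lambda>i. h (\<tau> i))"
  \<comment> \<open>The statistic is the fixed function \<open>?g\<close> of the assignment,
    measurable since \<open>?S\<close> is discrete, so its law is the image under \<open>?g\<close>
    of the law of the assignment.\<close>
  have RE2: "distr L borel (RE2 m n h \<rho>) = distr (distr L ?S \<rho>) borel ?g"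
    if "\<rho> \<in> measurable L ?S" for L :: "'c measure" and \<rho>
    using that by (subst distr_distr) (auto simp: comp_def RE2_def[abs_def])
  have inj: "inj_on h {1..m + n}"
    using assms(4) by (rule bij_betw_imp_inj_on)
  have "\<sigma> \<in> measurable M ?S" "\<sigma>' \<in> measurable M' ?S"
    using assms(7,10) by (auto simp: empirical_assignment_def)
  then show ?thesis
    by (simp add: RE2 distr_empirical_assignment[OF assms(1,2) inj assms(5-7)]
        distr_empirical_assignment[OF assms(1,2) inj assms(8-10)])
qed

end
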